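(* Let $F:\mathbb{R}^m\to\mathbb{R}^m$ be a continuously differentiable mapping such that the image $F(\mathbb{R}^m)=\{F(x)\mid x\in\mathbb{R}^m\}$ is a closed set. Assume that $|\nabla F(x)|\neq 0$ for every $x\in\mathbb{R}^m$ with $F(x)\neq 0$. Then the variational inequality problem VI$(\mathbb{R}^m,F)$ has a solution.
   Context: $\nabla F(x)$ denotes the Jacobian matrix of $F$ at $x$, and $|\nabla F(x)|$ denotes its determinant. For a set $K\subseteq\mathbb{R}^m$ and a mapping $F:K\to\mathbb{R}^m$, a solution of VI$(K,F)$ is a point $x^*\in K$ such that $\langle F(x^* ),x-x^*\rangle\ge 0$ for all $x\in K$. *)

theory Defs
  imports "HOL-Analysis.Analysis"
begin

definition continuously_differentiable :: "(real ^ 'm \<Rightarrow> real ^ 'm) \<Rightarrow> bool" where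
  "continuously_differentiable F \<longleftrightarrow>
     (\<forall>x. F differentiable (at x)) \<and> continuous_on UNIV (\<lambda>x. jacobian F (at x))"

(* A mapping from K to R^m is represented by a total function;
   only its values on K are used. *)
definition is_VI_solution ::
  "(real ^ 'm) set \<Rightarrow> (real ^ 'm \<Rightarrow> real ^ 'm) \<Rightarrow> real ^ 'm \<Rightarrow> bool" where
  "is_VI_solution K F x \<longleftrightarrow> x \<in> K \<and> (\<forall>y\<in>K. F x \<bullet> (y - x) \<ge> 0)"

end

theory Submission
  imports Defs
begin

text \<open>A point where the norm of \<open>F\<close> is minimal exists because the range is closed. It is
  critical for the squared norm of \<open>F\<close>, so \<open>F x\<close> is orthogonal to the range of the derivative
  at \<open>x\<close>. If \<open>F x\<close> were nonzero, that range would be the whole space, which is impossible;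
  so \<open>x\<close> is a zero of \<open>F\<close>.\<close>

lemma min_norm_orthogonal_derivative:
  fixes f :: "'a::real_normed_vector \<Rightarrow> 'b::real_inner"
  assumes "(f has_derivative f') (at x)" and "\<And>y. norm (f x) \<le> norm (f y)"
  shows "f x \<bullet> f' h = 0"
proof -
  \<comment> \<open>The norm is squared because the norm itself is not differentiable at 0, and
    \<open>f x = 0\<close> is allowed here.\<close>
  have "((\<lambda>y. f y \<bullet> f y) has_derivative (\<lambda>h. f x \<bullet> f' h + f' h \<bullet> f x)) (at x)"
    by (intro has_derivative_inner assms(1))
  moreover have "\<forall>y\<in>UNIV. f x \<bullet> f x \<le> f y \<bullet> f y"
    using assms(2) by (simp add: norm_le)
  ultimately have "(\<lambda>h. f x \<bullet> f' h + f' h \<bullet> f x) = (\<lambda>h. 0)"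
    by (intro differential_zero_maxmin[OF UNIV_I open_UNIV]) auto
  then have "f x \<bullet> f' h + f' h \<bullet> f x = 0"
    by (rule fun_cong)
  then show ?thesis
    by (simp add: inner_commute)
qed

theorem theorem2:
  fixes F :: "real ^ 'm \<Rightarrow> real ^ 'm"
  assumes "continuously_differentiable F"
    and "closed (range F)"
    and "\<And>x. F x \<noteq> 0 \<Longrightarrow> det (jacobian F (at x)) \<noteq> 0"
  shows "\<exists>x. is_VI_solution UNIV F x"
proof -
  \<comment> \<open>In finite dimension the distance from 0 to a nonempty closed set is attained, by
    compactness of closed balls.\<close>
  obtain z where z: "z \<in> range F" "\<And>w. w \<in> range F \<Longrightarrow> dist 0 z \<le> dist 0 w"
    using distance_attains_inf[OF assms(2), of 0] by blast
  then obtain x where "z = F x"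
    by blast
  with z(2) have min: "norm (F x) \<le> norm (F y)" for y
    by simp
  let ?J = "jacobian F (at x)"
  have "(F has_derivative (*v) ?J) (at x)"
    using assms(1) by (simp add: continuously_differentiable_def jacobian_works)
  then have orth: "F x \<bullet> (?J *v h) = 0" for h
    using min by (rule min_norm_orthogonal_derivative)
  have "F x = 0"
  proof (rule ccontr)
    assume "F x \<noteq> 0"
    then have "invertible ?J"
      using assms(3) by (simp add: invertible_det_nz)
    then obtain B where "?J ** B = mat 1"
      by (auto simp: invertible_def)
    \<comment> \<open>With this preimage of \<open>F x\<close> as \<open>h\<close>,
      \<open>orth\<close> makes \<open>F x\<close> orthogonal to itself.\<close>
    then have "?J *v (B *v F x) = F x"
      by (simp add: matrix_vector_mul_assoc)
    with orth[of "B *v F x"] \<open>F x \<noteq> 0\<close> show False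
      by simp
  qed
  \<comment> \<open>At a zero of \<open>F\<close> every inner product in the inequality is
    0.\<close>
  then have "is_VI_solution UNIV F x"
    by (simp add: is_VI_solution_def)
  then show ?thesis ..
qed

end
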